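(* The totally ordered set $(\mathbb{R},\leq)$, where $\mathbb{R}=(\mathbb{R}_+^{*}\times\mathbb{R}_+^{*})/\approx$ is the set of equivalence classes of pairs of initial segments of $\mathbb{Q}_+^{*}$ with the order defined in the context, is continuous.
   Context: $\mathbb{Q}_+^{*}$ is the set of strictly positive rational numbers with its usual operations and order. An initial segment of $\mathbb{Q}_+^{*}$ is a nonempty proper subset $A\subset\mathbb{Q}_+^{*}$ such that (1) if $y\in A$, $x\in\mathbb{Q}_+^{*}$ and $x<y$, then $x\in A$; (2) if $x\in A$, then there exists $y\in A$ with $y>x$. $\mathbb{R}_+^{*}$ denotes the set of all initial segments of $\mathbb{Q}_+^{*}$, with the addition $A+A'=\{x+x' : x\in A,\ x'\in A'\}$ (again an initial segment). On $\mathbb{R}_+^{*}\times\mathbb{R}_+^{*}$ define the equivalence relation $(A,A')\approx(B,B')$ if and only if $A+B'=A'+B$. Here $\mathbb{R}$ denotes the quotient set $(\mathbb{R}_+^{*}\times\mathbb{R}_+^{*})/\approx$ (not a previously given field of real numbers), and $[(A,B)]$ the class of $(A,B)$. The (well-defined) strict order on $\mathbb{R}$ is $[(A,B)]<[(A',B')]$ if and only if $A+B'\subsetneq B+A'$, and $\leq$ means "$<$ or $=$"; $\leq$ is a total order. A totally ordered set $X$ is continuous if it is dense (for all $x<y$ in $X$ there is $z\in X$ with $x<z<y$) and has the Dedekind property: every cut of $X$ is a Dedekind cut. A cut of $X$ is a pair $(\mathcal{A},\mathcal{B})$ of nonempty subsets forming a partition of $X$ with $a<b$ for all $a\in\mathcal{A}$,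 $b\in\mathcal{B}$; it is a Dedekind cut if it has a separating element, i.e. an $s\in X$ with $a\leq s\leq b$ for all $a\in\mathcal{A}$, $b\in\mathcal{B}$. Equivalently, the Dedekind property says that every nonempty subset of $X$ that is bounded above has a supremum in $X$. *)

theory Defs
  imports Complex_Main
begin

definition initial_segment :: "rat set \<Rightarrow> bool" where
  "initial_segment A \<longleftrightarrow>
     A \<noteq> {} \<and> A \<subset> {0<..} \<and>
     (\<forall>y\<in>A. \<forall>x\<in>{0<..}. x < y \<longrightarrow> x \<in> A) \<and>
     (\<forall>x\<in>A. \<exists>y\<in>A. y > x)"

typedef init_seg = "{A. initial_segment A}"
  morphisms seg_set Abs_init_seg
proof -
  have "initial_segment {0<..<1}"
    unfolding initial_segment_def
  proof (intro conjI ballI impI)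
    show "{0<..<1::rat} \<noteq> {}" using dense[of "0::rat" 1] by auto
    have "(1::rat) \<in> {0<..}" "(1::rat) \<notin> {0<..<1}" by simp_all
    then show "{0<..<1::rat} \<subset> {0<..}" by fastforce
    fix x :: rat assume "x \<in> {0<..<1}"
    then show "\<exists>y\<in>{0<..<1}. y > x" using dense[of x 1] by fastforce
  qed auto
  then show ?thesis by blast
qed

setup_lifting type_definition_init_seg

lemma initial_segmentD:
  assumes "initial_segment A"
  shows "A \<noteq> {}" "x \<in> A \<Longrightarrow> 0 < x" "\<exists>u>0. u \<notin> A"
    "y \<in> A \<Longrightarrow> 0 < x \<Longrightarrow> x < y \<Longrightarrow> x \<in> A" "x \<in> A \<Longrightarrow> \<exists>y\<in>A. y > x"
  using assms unfolding initial_segment_def by fastforce+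

lemma initial_segment_less:
  assumes "initial_segment A" "a \<in> A" "b \<notin> A" "0 < b"
  shows "a < b"
  using assms initial_segmentD(4) by (metis linorder_neqE)

lemma initial_segment_add:
  assumes A: "initial_segment A" and B: "initial_segment B"
  shows "initial_segment {x + x' |x x'. x \<in> A \<and> x' \<in> B}" (is "initial_segment ?S")
  unfolding initial_segment_def
proof (intro conjI ballI impI)
  show "?S \<noteq> {}" using initial_segmentD(1)[OF A] initial_segmentD(1)[OF B] by blast
  obtain u v where uv: "u > 0" "u \<notin> A" "v > 0" "v \<notin> B"
    using initial_segmentD(3)[OF A] initial_segmentD(3)[OF B] by blast
  have "u + v \<notin> ?S"
  proof
    assume "u + v \<in> ?S"
    then obtain x x' where "x \<in> A" "x' \<in> B" "u + v = x + x'" by blast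
    then show False
      using initial_segment_less[OF A, of x u] initial_segment_less[OF B, of x' v] uv by linarith
  qed
  moreover have "?S \<subseteq> {0<..}"
    using initial_segmentD(2)[OF A] initial_segmentD(2)[OF B] by (auto intro: add_pos_pos)
  moreover have "u + v \<in> {0<..}" using uv by simp
  ultimately show "?S \<subset> {0<..}" by blast
next
  fix y x assume "y \<in> ?S" and x: "x \<in> {0<..}" "x < y"
  then obtain a b where ab: "a \<in> A" "b \<in> B" "y = a + b" by blast
  have pos: "0 < a" "0 < b" using ab initial_segmentD(2) A B by blast+
  define t where "t = x / y"
  have t: "0 < t" "t < 1" using x pos ab by (auto simp: t_def)
  have "t * a \<in> A" "t * b \<in> B"
    using initial_segmentD(4)[OF A ab(1)] initial_segmentD(4)[OF B ab(2)] t pos by simp_all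
  moreover have "x = t * a + t * b"
  proof -
    have "t * a + t * b = t * y" using ab(3) by (simp add: distrib_left)
    also have "\<dots> = x" using ab(3) pos by (simp add: t_def)
    finally show ?thesis ..
  qed
  ultimately show "x \<in> ?S" by blast
next
  fix x assume "x \<in> ?S"
  then obtain a b where ab: "a \<in> A" "b \<in> B" "x = a + b" by blast
  obtain a' where "a' \<in> A" "a < a'" using initial_segmentD(5)[OF A ab(1)] by blast
  with ab show "\<exists>y\<in>?S. y > x" by (intro bexI[of _ "a' + b"]) auto
qed

lemma initial_segment_gap:
  assumes C: "initial_segment C" and d: "0 < d"
  shows "\<exists>c\<in>C. c + d \<notin> C"
proof (rule ccontr)
  assume "\<not> ?thesis"
  then have step: "\<And>c. c \<in> C \<Longrightarrow> c + d \<in> C" by blast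
  obtain c where c: "c \<in> C" using initial_segmentD(1)[OF C] by blast
  have mem: "c + of_nat n * d \<in> C" for n
  proof (induction n)
    case 0 show ?case using c by simp
  next
    case (Suc n)
    from step[OF this] show ?case by (simp add: algebra_simps)
  qed
  obtain u where u: "u > 0" "u \<notin> C" using initial_segmentD(3)[OF C] by blast
  obtain n :: nat where "u < of_nat n * d"
    using ex_less_of_nat_mult[OF d] by blast
  moreover have "0 < c" using initial_segmentD(2)[OF C c] .
  ultimately show False using initial_segment_less[OF C mem u(2) u(1), of n] by linarith
qed

instantiation init_seg :: linordered_ab_semigroup_add
begin

lift_definition less_eq_init_seg :: "init_seg \<Rightarrow> init_seg \<Rightarrow> bool" is "(\<subseteq>)" .
lift_definition less_init_seg :: "init_seg \<Rightarrow> init_seg \<Rightarrow> bool" is "(\<subset>)" .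
lift_definition plus_init_seg :: "init_seg \<Rightarrow> init_seg \<Rightarrow> init_seg"
  is "\<lambda>A A'. {x + x' |x x'. x \<in> A \<and> x' \<in> A'}"
  by (simp add: initial_segment_add)

instance
proof
  fix A B C :: init_seg
  show "A < B \<longleftrightarrow> A \<le> B \<and> \<not> B \<le> A" by transfer blast
  show "A \<le> A" by transfer blast
  show "A \<le> B \<Longrightarrow> B \<le> C \<Longrightarrow> A \<le> C" by transfer blast
  show "A \<le> B \<Longrightarrow> B \<le> A \<Longrightarrow> A = B" by transfer blast
  show "A \<le> B \<or> B \<le> A"
  proof transfer
    fix A B :: "rat set"
    assume A: "initial_segment A" and B: "initial_segment B"
    show "A \<subseteq> B \<or> B \<subseteq> A"
    proof (rule disjCI, rule subsetI)
      fix x assume "\<not> B \<subseteq> A" and x: "x \<in> A"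
      then obtain b where b: "b \<in> B" "b \<notin> A" by blast
      have "0 < x" "0 < b" using initial_segmentD(2) A B x b(1) by blast+
      with initial_segment_less[OF A x b(2)] show "x \<in> B"
        using initial_segmentD(4)[OF B b(1)] by blast
    qed
  qed
  show "A + B = B + A"
  proof transfer
    fix A B :: "rat set"
    show "{x + x' |x x'. x \<in> A \<and> x' \<in> B} = {x + x' |x x'. x \<in> B \<and> x' \<in> A}"
      by (auto intro: add.commute)
  qed
  show "A \<le> B \<Longrightarrow> C + A \<le> C + B" by transfer blast
  show "A + B + C = A + (B + C)"
  proof transfer
    fix A B C :: "rat set"
    let ?L = "{x + x' |x x'. x \<in> {x + x' |x x'. x \<in> A \<and> x' \<in> B} \<and> x' \<in> C}"
    let ?R = "{x + x' |x x'. x \<in> A \<and> x' \<in> {x + x' |x x'. x \<in> B \<and> x' \<in> C}}"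
    show "?L = ?R"
    proof (rule set_eqI)
      fix z
      have "z \<in> ?L \<longleftrightarrow> (\<exists>a\<in>A. \<exists>b\<in>B. \<exists>c\<in>C. z = a + b + c)" by blast
      also have "\<dots> \<longleftrightarrow> (\<exists>a\<in>A. \<exists>b\<in>B. \<exists>c\<in>C. z = a + (b + c))"
        by (simp only: add.assoc)
      also have "\<dots> \<longleftrightarrow> z \<in> ?R" by blast
      finally show "z \<in> ?L \<longleftrightarrow> z \<in> ?R" .
    qed
  qed
qed

end

lemma init_seg_add_strict_mono:
  fixes A B C :: init_seg
  assumes "A < B" shows "A + C < B + C"
  using assms
proof transfer
  fix A B C :: "rat set"
  assume "initial_segment A" "initial_segment B" "initial_segment C" and AB: "A \<subset> B"
  note A = \<open>initial_segment A\<close> and B = \<open>initial_segment B\<close> and C = \<open>initial_segment C\<close>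
  let ?S = "\<lambda>A. {x + x' |x x'. x \<in> A \<and> x' \<in> C}"
  obtain b where b: "b \<in> B" "b \<notin> A" using AB by blast
  obtain b' where b': "b' \<in> B" "b < b'" using initial_segmentD(5)[OF B b(1)] by blast
  obtain c where c: "c \<in> C" "c + (b' - b) \<notin> C"
    using initial_segment_gap[OF C, of "b' - b"] b' by auto
  have pos: "0 < b" "0 < c" using b c initial_segmentD(2) B C by blast+
  have "b' + c \<notin> ?S A"
  proof
    assume "b' + c \<in> ?S A"
    then obtain x x' where "x \<in> A" "x' \<in> C" "b' + c = x + x'" by blast
    then show False
      using initial_segment_less[OF A, of x b] initial_segment_less[OF C, of x' "c + (b' - b)"]
        b b' c pos by linarith
  qed
  moreover have "b' + c \<in> ?S B" using b' c by blast
  moreover have "?S A \<subseteq> ?S B" using AB by blast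
  ultimately show "?S A \<subset> ?S B" by blast
qed

lemma init_seg_add_less_cancel: "A + C < B + C \<longleftrightarrow> A < B" for A B C :: init_seg
  by (metis init_seg_add_strict_mono less_asym linorder_neqE)

lemma init_seg_add_cancel: "A + C = B + C \<longleftrightarrow> A = B" for A B C :: init_seg
  by (metis init_seg_add_less_cancel linorder_neqE less_irrefl)

fun seg_equiv :: "init_seg \<times> init_seg \<Rightarrow> init_seg \<times> init_seg \<Rightarrow> bool" where
  "seg_equiv (A, A') (B, B') \<longleftrightarrow> A + B' = A' + B"

quotient_type seg_real = "init_seg \<times> init_seg" / seg_equiv
proof (rule equivpI)
  show "reflp seg_equiv" by (auto simp: reflp_def add.commute)
  show "symp seg_equiv" by (auto simp: symp_def add.commute)
  show "transp seg_equiv"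
  proof (rule transpI, clarsimp)
    fix A A' B B' C C' :: init_seg
    assume 1: "A + B' = A' + B" and 2: "B + C' = B' + C"
    have "A + C' + B' = (A + B') + C'" by (simp add: ac_simps)
    also have "\<dots> = A' + (B + C')" by (simp add: 1 ac_simps)
    also have "\<dots> = A' + C + B'" by (simp add: 2 ac_simps)
    finally show "A + C' = A' + C" by (simp only: init_seg_add_cancel)
  qed
qed

lemma seg_less_cong:
  fixes A B C D A' B' C' D' :: init_seg
  assumes "A + B' = B + A'" "C + D' = D + C'" "A + D < B + C"
  shows "A' + D' < B' + C'"
proof -
  have "A' + D' + (B + C) = (A + D) + (B' + C')"
  proof -
    have "A' + D' + (B + C) = (B + A') + (C + D')" by (simp add: ac_simps)
    also have "\<dots> = (A + B') + (D + C')" using assms by simp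
    finally show ?thesis by (simp add: ac_simps)
  qed
  also have "\<dots> < (B + C) + (B' + C')" using assms(3) by (rule init_seg_add_strict_mono)
  finally show ?thesis by (simp add: init_seg_add_less_cancel add.commute[of "B + C"])
qed

instantiation seg_real :: linorder
begin

lift_definition less_seg_real :: "seg_real \<Rightarrow> seg_real \<Rightarrow> bool"
  is "\<lambda>(A, B) (A', B'). A + B' < B + A'"
proof (clarsimp, rule iffI)
  fix A B A' B' C D C' D' :: init_seg
  assume e: "A + B' = B + A'" "C + D' = D + C'"
  show "A + D < B + C \<Longrightarrow> A' + D' < B' + C'" by (rule seg_less_cong[OF e])
  show "A' + D' < B' + C' \<Longrightarrow> A + D < B + C"
    by (rule seg_less_cong) (use e in \<open>simp_all add: add.commute\<close>)
qed

definition less_eq_seg_real :: "seg_real \<Rightarrow> seg_real \<Rightarrow> bool" where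
  "x \<le> y \<longleftrightarrow> x < y \<or> x = y" for x y :: seg_real

instance
proof
  fix x y z :: seg_real
  have irr: "\<not> x < x" for x :: seg_real by transfer (auto simp: add.commute)
  have tr: "x < z" if "x < y" "y < z" for x y z :: seg_real
    using that
  proof (transfer, clarsimp)
    fix A B C D E F :: init_seg
    assume 1: "A + D < B + C" and 2: "C + F < D + E"
    have "A + F + D = A + D + F" by (simp add: ac_simps)
    also have "\<dots> < B + C + F" using 1 by (rule init_seg_add_strict_mono)
    also have "\<dots> = C + F + B" by (simp add: ac_simps)
    also have "\<dots> < D + E + B" using 2 by (rule init_seg_add_strict_mono)
    also have "\<dots> = B + E + D" by (simp add: ac_simps)
    finally show "A + F < B + E" by (simp only: init_seg_add_less_cancel)
  qed
  have tot: "x < y \<or> x = y \<or> y < x"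
    by transfer (clarsimp, metis add.commute linorder_neqE)
  show "x < y \<longleftrightarrow> x \<le> y \<and> \<not> y \<le> x"
    using irr tr unfolding less_eq_seg_real_def by metis
  show "x \<le> x" unfolding less_eq_seg_real_def by blast
  show "x \<le> y \<Longrightarrow> y \<le> z \<Longrightarrow> x \<le> z" using tr unfolding less_eq_seg_real_def by blast
  show "x \<le> y \<Longrightarrow> y \<le> x \<Longrightarrow> x = y" using irr tr unfolding less_eq_seg_real_def by metis
  show "x \<le> y \<or> y \<le> x" using tot unfolding less_eq_seg_real_def by blast
qed

end

text \<open>The ambient totally ordered set of the notions below is the whole type \<open>'a\<close>.\<close>

definition is_cut :: "'a::linorder set \<Rightarrow> 'a set \<Rightarrow> bool" where
  "is_cut \<A> \<B> \<longleftrightarrow> \<A> \<noteq> {} \<and> \<B> \<noteq> {} \<and> \<A> \<union> \<B> = UNIV \<and> \<A> \<inter> \<B> = {} \<and>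
     (\<forall>a\<in>\<A>. \<forall>b\<in>\<B>. a < b)"

definition is_Dedekind_cut :: "'a::linorder set \<Rightarrow> 'a set \<Rightarrow> bool" where
  "is_Dedekind_cut \<A> \<B> \<longleftrightarrow> is_cut \<A> \<B> \<and> (\<exists>s. \<forall>a\<in>\<A>. \<forall>b\<in>\<B>. a \<le> s \<and> s \<le> b)"

definition continuous_order :: "'a::linorder itself \<Rightarrow> bool" where
  "continuous_order (_ :: 'a itself) \<longleftrightarrow>
     (\<forall>x y :: 'a. x < y \<longrightarrow> (\<exists>z. x < z \<and> z < y)) \<and>
     (\<forall>\<A> \<B> :: 'a set. is_cut \<A> \<B> \<longrightarrow> is_Dedekind_cut \<A> \<B>)"

end

(* Suprema in the library reals turn initial segments into positive reals, additively and
   strictly monotonically. Hence [(A, B)] \<mapsto> sup A - sup B is an order isomorphism onto the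
   library reals, from which continuity is pulled back. *)
theory Submission
  imports Defs
begin

lift_definition seg_Sup :: "init_seg \<Rightarrow> real" is "\<lambda>A. Sup (real_of_rat ` A)" .

text \<open>A positive rational outside \<open>A\<close> exceeds every element of \<open>A\<close>,
  so the image of \<open>A\<close> is bounded above and its \<open>Sup\<close> is a genuine
  supremum.\<close>

lemma initial_segment_Sup_upper:
  assumes A: "initial_segment A" and x: "x \<in> A"
  shows "real_of_rat x \<le> Sup (real_of_rat ` A)"
proof (rule cSup_upper)
  obtain u where u: "u > 0" "u \<notin> A" using initial_segmentD(3)[OF A] by blast
  have "real_of_rat y \<le> real_of_rat u" if "y \<in> A" for y
    using initial_segment_less[OF A that u(2,1)] by (simp add: of_rat_less_eq)
  then show "bdd_above (real_of_rat ` A)" by (rule bdd_aboveI2)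
qed (use x in simp)

text \<open>A point \<open>b\<close> of \<open>B\<close> outside \<open>A\<close> bounds
  \<open>A\<close> from above. Since \<open>B\<close> has no greatest element, some
  \<open>b'\<close> in \<open>B\<close> lies beyond \<open>b\<close>, which keeps the two suprema
  apart.\<close>

lemma seg_Sup_strict_mono: "A < B \<Longrightarrow> seg_Sup A < seg_Sup B"
proof transfer
  fix A B :: "rat set"
  assume A: "initial_segment A" and B: "initial_segment B" and "A \<subset> B"
  then obtain b where b: "b \<in> B" "b \<notin> A" by blast
  obtain b' where b': "b' \<in> B" "b < b'" using initial_segmentD(5)[OF B b(1)] by blast
  have "Sup (real_of_rat ` A) \<le> real_of_rat b"
  proof (rule cSUP_least)
    fix x assume "x \<in> A"
    then show "real_of_rat x \<le> real_of_rat b"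
      using initial_segment_less[OF A _ b(2)] initial_segmentD(2)[OF B b(1)]
      by (force simp: of_rat_less_eq)
  qed (rule initial_segmentD(1)[OF A])
  also have "\<dots> < real_of_rat b'" using b'(2) by (simp add: of_rat_less)
  also have "\<dots> \<le> Sup (real_of_rat ` B)" by (rule initial_segment_Sup_upper[OF B b'(1)])
  finally show "Sup (real_of_rat ` A) < Sup (real_of_rat ` B)" .
qed

lemma seg_Sup_less_iff: "seg_Sup A < seg_Sup B \<longleftrightarrow> A < B"
  by (metis seg_Sup_strict_mono less_asym less_irrefl linorder_neqE)

lemma seg_Sup_add: "seg_Sup (A + B) = seg_Sup A + seg_Sup B"
proof transfer
  fix A B :: "rat set"
  assume A: "initial_segment A" and B: "initial_segment B"
  let ?S = "{x + x' |x x'. x \<in> A \<and> x' \<in> B}"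
  let ?sup = "\<lambda>A. Sup (real_of_rat ` A)"
  note S = initial_segment_add[OF A B]
  show "?sup ?S = ?sup A + ?sup B"
  proof (rule antisym)
    show "?sup ?S \<le> ?sup A + ?sup B"
    proof (rule cSUP_least)
      fix z assume "z \<in> ?S"
      then obtain x y where "x \<in> A" "y \<in> B" "z = x + y" by blast
      then show "real_of_rat z \<le> ?sup A + ?sup B"
        by (simp add: of_rat_add add_mono initial_segment_Sup_upper A B)
    qed (rule initial_segmentD(1)[OF S])
    \<comment> \<open>For the converse inequality, one summand is freed at a time: with
      \<open>x\<close> fixed, the supremum over \<open>y\<close> in \<open>B\<close> is taken first,
      then the one over \<open>x\<close> in \<open>A\<close>.\<close>
    have "real_of_rat x \<le> ?sup ?S - ?sup B" if x: "x \<in> A" for x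
    proof -
      have "?sup B \<le> ?sup ?S - real_of_rat x"
      proof (rule cSUP_least)
        fix y assume "y \<in> B"
        then have "x + y \<in> ?S" using x by blast
        from initial_segment_Sup_upper[OF S this]
        show "real_of_rat y \<le> ?sup ?S - real_of_rat x" by (simp add: of_rat_add)
      qed (rule initial_segmentD(1)[OF B])
      then show ?thesis by simp
    qed
    then have "?sup A \<le> ?sup ?S - ?sup B"
      by (intro cSUP_least initial_segmentD(1)[OF A])
    then show "?sup A + ?sup B \<le> ?sup ?S" by simp
  qed
qed

text \<open>Density of the rationals in the reals yields both an element and, above each element, a
  larger one. This segment serves as the preimage of \<open>r\<close> under
  \<open>seg_Sup\<close>.\<close>

lemma initial_segment_below_real:
  fixes r :: real
  assumes "0 < r"
  shows "initial_segment {q. 0 < q \<and> real_of_rat q < r}" (is "initial_segment ?A")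
  unfolding initial_segment_def
proof (intro conjI ballI impI)
  show "?A \<noteq> {}" using of_rat_dense[OF assms] by auto
  obtain q where "r < real_of_rat q" using of_rat_dense[of r "r + 1"] by auto
  moreover from this have "0 < q" using assms by (metis less_trans zero_less_of_rat_iff)
  ultimately have "q \<in> {0<..}" "q \<notin> ?A" by auto
  then show "?A \<subset> {0<..}" by auto
next
  fix y x assume "y \<in> ?A" "x \<in> {0<..}" "x < y"
  then show "x \<in> ?A" using of_rat_less[of x y, where 'a = real] by auto
next
  fix x assume x: "x \<in> ?A"
  then obtain q where "real_of_rat x < real_of_rat q" "real_of_rat q < r"
    using of_rat_dense[of "real_of_rat x" r] by auto
  with x show "\<exists>y\<in>?A. y > x" by (intro bexI[of _ q]) (auto simp: of_rat_less)
qed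

lemma seg_Sup_surj_pos:
  fixes r :: real
  assumes "0 < r"
  shows "\<exists>A. seg_Sup A = r"
  using assms
proof transfer
  fix r :: real assume r: "0 < r"
  let ?A = "{q. 0 < q \<and> real_of_rat q < r}"
  note A = initial_segment_below_real[OF r]
  have "Sup (real_of_rat ` ?A) = r"
  proof (rule antisym)
    show "Sup (real_of_rat ` ?A) \<le> r"
      by (rule cSUP_least[OF initial_segmentD(1)[OF A]]) auto
    show "r \<le> Sup (real_of_rat ` ?A)"
    proof (rule ccontr)
      assume "\<not> ?thesis"
      \<comment> \<open>The maximum with 0 forces the rational chosen next to be positive, hence a
        member of \<open>?A\<close> above its supremum.\<close>
      then have "max 0 (Sup (real_of_rat ` ?A)) < r" using r by simp
      then obtain q where q: "max 0 (Sup (real_of_rat ` ?A)) < real_of_rat q" "real_of_rat q < r"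
        using of_rat_dense by blast
      then have "q \<in> ?A" by simp
      from initial_segment_Sup_upper[OF A this] q(1) show False by simp
    qed
  qed
  with A show "\<exists>A\<in>{A. initial_segment A}. Sup (real_of_rat ` A) = r" by blast
qed

text \<open>A pair is read as a formal difference; additivity of \<open>seg_Sup\<close> makes the
  value independent of the representative.\<close>

lift_definition seg_real_val :: "seg_real \<Rightarrow> real"
  is "\<lambda>(A, B). seg_Sup A - seg_Sup B"
proof clarsimp
  fix A B C D :: init_seg
  assume "A + D = B + C"
  then have "seg_Sup A + seg_Sup D = seg_Sup B + seg_Sup C" by (metis seg_Sup_add)
  then show "seg_Sup A - seg_Sup B = seg_Sup C - seg_Sup D" by simp
qed

lemma seg_real_val_less_iff: "seg_real_val x < seg_real_val y \<longleftrightarrow> x < y"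
proof (transfer, clarsimp)
  fix A B C D :: init_seg
  have "A + D < B + C \<longleftrightarrow> seg_Sup A + seg_Sup D < seg_Sup B + seg_Sup C"
    by (metis seg_Sup_less_iff seg_Sup_add)
  then show "seg_Sup A - seg_Sup B < seg_Sup C - seg_Sup D \<longleftrightarrow> A + D < B + C" by auto
qed

lemma surj_seg_real_val: "surj seg_real_val"
  unfolding surj_def
proof
  fix r :: real
  \<comment> \<open>Only positive reals are values of \<open>seg_Sup\<close>, so \<open>r\<close> is
    written as a difference of two positive numbers by adding \<open>\<bar>r\<bar> + 1\<close> to
    both \<open>r\<close> and 0.\<close>
  have "0 < r + \<bar>r\<bar> + 1" "0 < \<bar>r\<bar> + 1" by linarith+
  then obtain A B where A: "seg_Sup A = r + \<bar>r\<bar> + 1" and B: "seg_Sup B = \<bar>r\<bar> + 1"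
    using seg_Sup_surj_pos by meson
  have "seg_real_val (abs_seg_real (A, B)) = r"
    by (simp add: seg_real_val.abs_eq A B)
  then show "\<exists>x. r = seg_real_val x" by blast
qed

text \<open>Both halves of continuity are solved in the target and pulled back: surjectivity
  provides a preimage of the point found there, and \<open>less_iff\<close> reflects the
  inequalities.\<close>

lemma continuous_order_if_order_iso:
  fixes f :: "'a::linorder \<Rightarrow> 'b::{conditionally_complete_linorder, dense_order}"
  assumes less_iff: "\<And>x y. f x < f y \<longleftrightarrow> x < y" and surj: "surj f"
  shows "continuous_order TYPE('a)"
  unfolding continuous_order_def is_Dedekind_cut_def
proof (intro conjI allI impI)
  fix x y :: 'a assume "x < y"
  then have "f x < f y" by (simp add: less_iff)
  then obtain w where w: "f x < w" "w < f y" using dense by blast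
  obtain z where "w = f z" using surj by (rule surjE)
  with w have "x < z \<and> z < y" by (simp add: less_iff)
  then show "\<exists>z. x < z \<and> z < y" ..
next
  fix \<A> \<B> :: "'a set" assume cut: "is_cut \<A> \<B>"
  then show "is_cut \<A> \<B>" .
  have le_iff: "f x \<le> f y \<longleftrightarrow> x \<le> y" for x y by (simp add: less_iff flip: not_less)
  from cut obtain a\<^sub>0 b\<^sub>0 where ab\<^sub>0: "a\<^sub>0 \<in> \<A>" "b\<^sub>0 \<in> \<B>" by (auto simp: is_cut_def)
  have le: "f a \<le> f b" if "a \<in> \<A>" "b \<in> \<B>" for a b
    using cut that by (simp add: is_cut_def le_iff less_imp_le)
  \<comment> \<open>The separating element is the preimage of the supremum of the lower class; each
    \<open>f b\<close> with \<open>b\<close> in the upper class is an upper bound of that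
    image.\<close>
  obtain s where s: "Sup (f ` \<A>) = f s" using surj by (rule surjE)
  have bdd: "bdd_above (f ` \<A>)" using le ab\<^sub>0(2) by (intro bdd_aboveI2)
  have "a \<le> s" if "a \<in> \<A>" for a
    using cSUP_upper[OF that bdd] by (simp add: s le_iff)
  moreover have "s \<le> b" if "b \<in> \<B>" for b
    using cSUP_least[of \<A> f "f b"] ab\<^sub>0(1) le that by (auto simp: s le_iff)
  ultimately show "\<exists>s. \<forall>a\<in>\<A>. \<forall>b\<in>\<B>. a \<le> s \<and> s \<le> b" by blast
qed

theorem mainTheorem2: "continuous_order TYPE(seg_real)"
  by (rule continuous_order_if_order_iso[OF seg_real_val_less_iff surj_seg_real_val])

end
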